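(* For every integer $N \ge 3$, $$Q(N,1,=) = N- \left \lfloor \frac{N}{2} \right \rfloor.$$
   Context: There are $N$ balls $b_1,\dots,b_N$, each colored red or green, with strictly fewer green than red balls (a Red-green coloring). For an integer $0\le p<\frac N2$, the coloring is $p$-equal if exactly $p$ balls are green. A comparison consists of choosing two balls and being told whether or not they have the same color (only "same" or "different" is answered). A method is an adaptive deterministic strategy: each comparison may depend on the answers to the previous ones. $Q(N,p,=)$ is the minimum integer $k$ such that there exists a method which, for every $p$-equal Red-green coloring of the $N$ balls (it being known in advance that the coloring is $p$-equal), determines for sure the color of every ball after at most $k$ comparisons. *)

theory Defs
  imports Main
begin

datatype color = Red | Green

text \<open>The balls are the numbers \<open>1, \<dots>, N\<close>; values of a coloring outside \<open>{1..N}\<close> are irrelevant.\<close>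

type_synonym coloring = "nat \<Rightarrow> color"

definition balls :: "nat \<Rightarrow> nat set" where
  "balls N = {1..N}"

definition red_green_coloring :: "nat \<Rightarrow> coloring \<Rightarrow> bool" where
  "red_green_coloring N c \<longleftrightarrow>
     card {i \<in> balls N. c i = Green} < card {i \<in> balls N. c i = Red}"

definition p_equal :: "nat \<Rightarrow> nat \<Rightarrow> coloring \<Rightarrow> bool" where
  "p_equal N p c \<longleftrightarrow>
     red_green_coloring N c \<and> card {i \<in> balls N. c i = Green} = p"

text \<open>
  An adaptive deterministic method is a binary decision tree: \<open>Compare i j s t\<close> compares
  balls \<open>i\<close> and \<open>j\<close> and continues with \<open>s\<close> on the answer ``same'' and with \<open>t\<close> on the answer
  ``different''. A leaf \<open>Announce d\<close> stops and claims that the coloring is \<open>d\<close>; the claim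
  can thus only depend on the answers received.
\<close>

datatype strategy = Announce coloring | Compare nat nat strategy strategy

primrec valid_strategy :: "nat \<Rightarrow> strategy \<Rightarrow> bool" where
  "valid_strategy N (Announce d) \<longleftrightarrow> True"
| "valid_strategy N (Compare i j s t) \<longleftrightarrow>
     i \<in> balls N \<and> j \<in> balls N \<and> i \<noteq> j \<and> valid_strategy N s \<and> valid_strategy N t"

primrec announced :: "strategy \<Rightarrow> coloring \<Rightarrow> coloring" where
  "announced (Announce d) c = d"
| "announced (Compare i j s t) c = (if c i = c j then announced s c else announced t c)"

primrec comparisons :: "strategy \<Rightarrow> coloring \<Rightarrow> nat" where
  "comparisons (Announce d) c = 0"
| "comparisons (Compare i j s t) c =
     Suc (if c i = c j then comparisons s c else comparisons t c)"

definition determines_within :: "nat \<Rightarrow> nat \<Rightarrow> strategy \<Rightarrow> nat \<Rightarrow> bool" where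
  "determines_within N p s k \<longleftrightarrow>
     valid_strategy N s \<and>
     (\<forall>c. p_equal N p c \<longrightarrow>
        (\<forall>i \<in> balls N. announced s c i = c i) \<and> comparisons s c \<le> k)"

definition Q_equal :: "nat \<Rightarrow> nat \<Rightarrow> nat" where
  "Q_equal N p = (LEAST k. \<exists>s. determines_within N p s k)"

end

theory Submission
  imports Defs
begin

text \<open>
  With a single green ball, knowing the coloring means knowing where that ball is, so the state
  of any method is the set \<open>S\<close> of positions still possible for it. The answer ``same'' to a
  comparison of \<open>i\<close> and \<open>j\<close> removes \<open>i\<close> and \<open>j\<close> from \<open>S\<close>, whereas ``different'' cuts \<open>S\<close> down to
  \<open>S \<inter> {i, j}\<close>.

  For the lower bound (\<open>comparisons_lower_bound\<close>) an adversary answers ``same'' as long as two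
  candidates survive. This costs at most two candidates per comparison, and the last two
  candidates cost one comparison more. Only three candidates need care: there the adversary may
  have to answer ``different'', which again leaves two.

  For the upper bound (\<open>scan_correct\<close>), compare disjoint pairs until the answer is ``different''
  or at most two balls are left. If two candidates remain, comparing one of them with a ball
  known to be red decides between them. Since one or two balls stay unpaired, at most
  \<open>(N - 1) div 2\<close> pairs are compared, and the final test brings the total to at most
  \<open>(N - 1) div 2 + 1 = N - N div 2\<close>.
\<close>

definition green_at :: "nat \<Rightarrow> coloring" where
  "green_at x = (\<lambda>i. if i = x then Green else Red)"

lemma p_equal_1_green_at:
  assumes "N \<ge> 3" "x \<in> balls N"
  shows "p_equal N 1 (green_at x)"
proof -
  have green: "{i \<in> balls N. green_at x i = Green} = {x}"
    and red: "{i \<in> balls N. green_at x i = Red} = balls N - {x}"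
    using assms(2) by (auto simp: green_at_def)
  have "card (balls N - {x}) = N - 1"
    using assms(2) by (simp add: balls_def)
  then show ?thesis
    using assms(1) by (simp add: p_equal_def red_green_coloring_def green red)
qed

lemma p_equal_1_obtain_green:
  assumes "p_equal N 1 c"
  obtains x where "x \<in> balls N" "\<forall>i\<in>balls N. c i = green_at x i"
proof -
  from assms have "card {i \<in> balls N. c i = Green} = 1"
    by (simp add: p_equal_def)
  then obtain x where x: "{i \<in> balls N. c i = Green} = {x}"
    by (auto simp: card_1_singleton_iff)
  have "c i = green_at x i" if "i \<in> balls N" for i
  proof (cases "c i")
    case Red
    then have "i \<notin> {i \<in> balls N. c i = Green}" by simp
    with x Red show ?thesis by (simp add: green_at_def)
  next
    case Green
    with that have "i \<in> {i \<in> balls N. c i = Green}" by simp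
    with x Green show ?thesis by (simp add: green_at_def)
  qed
  moreover have "x \<in> balls N" using x by blast
  ultimately show thesis using that by blast
qed

text \<open>
  The induction on the decision tree must allow arbitrary candidate sets, because the adversary's
  answers lead to a subtree together with a smaller set. With a single candidate no comparison
  is required, which is why the bound starts at two candidates and why the adversary never
  lets their number drop to one before the end.
\<close>

lemma comparisons_lower_bound:
  assumes "finite S" "card S \<ge> 2"
    and "\<forall>x\<in>S. \<forall>y\<in>S. announced s (green_at x) y = green_at x y"
  shows "\<exists>x\<in>S. card S - card S div 2 \<le> comparisons s (green_at x)"
  using assms
proof (induction s arbitrary: S)
  case (Announce d)
  obtain x y where "x \<in> S" "y \<in> S" "x \<noteq> y"
    using Announce.prems(2) by (auto simp: card_le_Suc_iff numeral_2_eq_2)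
  \<comment> \<open>A leaf makes one claim, but \<open>x\<close> is green in one candidate coloring and red in another.\<close>
  then have "d x = green_at x x" "d x = green_at y x"
    using Announce.prems(3) unfolding announced.simps by blast+
  with \<open>x \<noteq> y\<close> show ?case by (simp add: green_at_def)
next
  case (Compare i j s t)
  define D where "D = {x \<in> S. green_at x i \<noteq> green_at x j}"
  have "D \<subseteq> {i, j}" by (auto simp: D_def green_at_def split: if_splits)
  then have "card D \<le> card {i, j}" by (intro card_mono) auto
  also have "\<dots> \<le> 2" by (cases "i = j") auto
  finally have D2: "card D \<le> 2" .
  have sub: "D \<subseteq> S" by (auto simp: D_def)
  then have fin: "finite D" and cardSD: "card (S - D) = card S - card D"
    using Compare.prems(1) by (auto simp: finite_subset card_Diff_subset)
  show ?case
  proof (cases "card (S - D) \<ge> 2")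
    case True
    have "\<forall>x\<in>S - D. \<forall>y\<in>S - D. announced s (green_at x) y = green_at x y"
      using Compare.prems(3) by (auto simp: D_def)
    with Compare.IH(1)[of "S - D"] True Compare.prems(1) obtain x where
      x: "x \<in> S - D" "card (S - D) - card (S - D) div 2 \<le> comparisons s (green_at x)"
      by auto
    have "card S - card S div 2 \<le> Suc (card (S - D) - card (S - D) div 2)"
      using D2 cardSD by linarith
    with x show ?thesis by (intro bexI[of _ x]) (auto simp: D_def)
  next
    case False
    with D2 cardSD Compare.prems(2) consider "card S = 2" | "card S = 3" "card D = 2"
      by linarith
    then show ?thesis
    proof cases
      case 1
      then have "S \<noteq> {}" by auto
      with 1 show ?thesis by auto
    next
      case 2
      have "\<forall>x\<in>D. \<forall>y\<in>D. announced t (green_at x) y = green_at x y"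
        using Compare.prems(3) by (auto simp: D_def)
      with Compare.IH(2)[of D] 2 fin obtain x where
        "x \<in> D" "1 \<le> comparisons t (green_at x)"
        by auto
      with 2 show ?thesis by (intro bexI[of _ x]) (auto simp: D_def)
    qed
  qed
qed

definition decide :: "nat \<Rightarrow> nat \<Rightarrow> nat \<Rightarrow> strategy" where
  "decide r u v = Compare u r (Announce (green_at v)) (Announce (green_at u))"

text \<open>
  The scan starts in a state where the balls \<open>1, \<dots>, a\<close> are known to be red. For \<open>a > 0\<close> the
  reference ball of the final test can therefore be ball \<open>1\<close>. If already the first pair
  differs, ball \<open>3\<close> lies outside that pair and is red.
\<close>

function scan :: "nat \<Rightarrow> nat \<Rightarrow> strategy" where
  "scan N a =
     (let test = decide (if a = 0 then 3 else 1) (a + 1) (a + 2) in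
      if N \<le> a + 1 then Announce (green_at N)
      else if N = a + 2 then test
      else Compare (a + 1) (a + 2) (scan N (a + 2)) test)"
  by auto
termination by (relation "measure (\<lambda>(N, a). N - a)") auto

declare scan.simps [simp del]

lemma valid_scan:
  assumes "N \<ge> 3"
  shows "valid_strategy N (scan N a)"
  using assms
  by (induction N a rule: scan.induct)
     (subst scan.simps, auto simp: Let_def decide_def balls_def)

text \<open>
  The bound is preserved because a scanned pair costs one comparison and settles two balls.
  A scan that stops early pays one comparison for the pair and one for the test, which
  the bound allows since then \<open>N - a \<ge> 3\<close>.
\<close>

lemma scan_correct:
  assumes "N \<ge> 3" "a < x" "x \<le> N"
    and "\<forall>i\<in>balls N. c i = green_at x i"
  shows "announced (scan N a) c = green_at x \<and>
         comparisons (scan N a) c \<le> (N - a) - (N - a) div 2"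
  using assms
proof (induction N a rule: scan.induct)
  case (1 N a)
  have c: "c i = (if i = x then Green else Red)" if "1 \<le> i" "i \<le> N" for i
    using 1(5) that by (auto simp: balls_def green_at_def)
  consider "N = a + 1" | "N = a + 2" | "N \<ge> a + 3"
    using "1.prems" by linarith
  then show ?case
  proof cases
    case 1
    with "1.prems" have "x = N" by simp
    with 1 show ?thesis by (subst (1 2) scan.simps) simp
  next
    case 2
    with "1.prems" have "x = a + 1 \<or> x = a + 2" by auto
    with 2 "1.prems"(1) show ?thesis
      by (subst (1 2) scan.simps) (auto simp: Let_def decide_def c)
  next
    case 3
    show ?thesis
    proof (cases "x \<le> a + 2")
      case True
      with "1.prems" have "x = a + 1 \<or> x = a + 2" by auto
      moreover have "2 \<le> (N - a) - (N - a) div 2"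
        using 3 by linarith
      ultimately show ?thesis using 3
        by (subst (1 2) scan.simps) (auto simp: Let_def decide_def c)
    next
      case False
      have IH: "announced (scan N (a + 2)) c = green_at x \<and>
          comparisons (scan N (a + 2)) c \<le> (N - (a + 2)) - (N - (a + 2)) div 2"
        using "1.IH"[OF refl] 3 False "1.prems" by simp
      have "Suc ((N - (a + 2)) - (N - (a + 2)) div 2) \<le> (N - a) - (N - a) div 2"
        using 3 by linarith
      with IH False 3 show ?thesis
        by (subst (1 2) scan.simps) (auto simp: Let_def c)
    qed
  qed
qed

theorem proposition2:
  fixes N :: nat
  assumes "N \<ge> 3"
  shows "Q_equal N 1 = N - N div 2"
  unfolding Q_equal_def
proof (rule Least_equality)
  have "(\<forall>i\<in>balls N. announced (scan N 0) c i = c i) \<and>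
        comparisons (scan N 0) c \<le> N - N div 2" if c: "p_equal N 1 c" for c
  proof -
    obtain x where x: "x \<in> balls N" "\<forall>i\<in>balls N. c i = green_at x i"
      using p_equal_1_obtain_green[OF c] .
    then have "0 < x" "x \<le> N" by (auto simp: balls_def)
    from scan_correct[OF assms this x(2)] x(2) show ?thesis by simp
  qed
  with valid_scan[OF assms] show "\<exists>s. determines_within N 1 s (N - N div 2)"
    unfolding determines_within_def by blast
next
  fix k
  assume "\<exists>s. determines_within N 1 s k"
  then obtain s where s: "determines_within N 1 s k" ..
  have correct: "\<forall>i\<in>balls N. announced s (green_at x) i = green_at x i"
    and cost: "comparisons s (green_at x) \<le> k" if "x \<in> balls N" for x
    using s p_equal_1_green_at[OF assms that] by (auto simp: determines_within_def)
  have card_balls: "finite (balls N)" "card (balls N) = N"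
    by (simp_all add: balls_def)
  then have "\<exists>x\<in>balls N. card (balls N) - card (balls N) div 2 \<le> comparisons s (green_at x)"
    using assms correct by (intro comparisons_lower_bound) auto
  then obtain x where "x \<in> balls N" "N - N div 2 \<le> comparisons s (green_at x)"
    unfolding card_balls by blast
  with cost show "N - N div 2 \<le> k"
    by (meson order.trans)
qed

end
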